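(* For $d=6$, the sequence of compatible pairs $$S^{\diamond}:=((0,2),(2,3),(1,3),(1,2),(1,1),(1,0))$$ (which defines the sign pattern $\Sigma_{1,4,2}=(+,-,-,-,-,+,+)$) is not realizable. That is, there is no monic real polynomial $P=x^6+\sum_{j=0}^{5}b_jx^j$ without vanishing coefficients that realizes $S^{\diamond}$, i.e. such that all real roots of $P$ and of all its non-constant derivatives are distinct and such that the numbers of (positive, negative) roots of $P$, $P'$, $P''$, $P'''$, $P^{(4)}$, $P^{(5)}$ are respectively $(0,2)$, $(2,3)$, $(1,3)$, $(1,2)$, $(1,1)$, $(1,0)$.
   Context: Polynomials are real, univariate, monic of degree $d$, $P=x^d+\sum_{j=0}^{d-1}b_jx^j$, with all $b_j\neq 0$. The sign pattern of $P$ is $(+,\mathrm{sgn}(b_{d-1}),\ldots,\mathrm{sgn}(b_0))$; $\Sigma_{m_1,m_2,\ldots,m_n}$ denotes the sign pattern consisting of $m_1$ signs $+$, followed by $m_2$ signs $-$, followed by $m_3$ signs $+$, etc. ($m_1+\cdots+m_n=d+1$). For $1\le j\le d$, let $p_j$ and $n_j$ be the numbers of positive and negative roots of the derivative $P^{(d-j)}$, counted with multiplicity. When all real roots of $P$ and of all its non-constant derivatives are distinct, $P$ is said to realize the sequence of compatible pairs (SCP) $S_d=((p_d,n_d),(p_{d-1},n_{d-1}),\ldots,(p_1,n_1))$. An SCP is realizable if some such polynomial $P$ realizes it. An SCP defines the sign pattern of $P$ by the rule $\mathrm{sgn}(b_j)=(-1)^{p_{d-j}}$. *)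

theory Defs
  imports Complex_Main "HOL-Computational_Algebra.Polynomial"
begin

definition num_pos_roots :: "real poly \<Rightarrow> nat" where
  "num_pos_roots p = (\<Sum>x | x > 0 \<and> poly p x = 0. order x p)"

definition num_neg_roots :: "real poly \<Rightarrow> nat" where
  "num_neg_roots p = (\<Sum>x | x < 0 \<and> poly p x = 0. order x p)"

text \<open>
  The real roots of a polynomial and of all its non-constant derivatives, taken together,
  are distinct: every real root of each of them is simple, and no two of them share a real root.
\<close>

definition all_real_roots_distinct :: "real poly \<Rightarrow> bool" where
  "all_real_roots_distinct P \<longleftrightarrow>
     (\<forall>k<degree P. \<forall>x. poly ((pderiv ^^ k) P) x = 0 \<longrightarrow> order x ((pderiv ^^ k) P) = 1) \<and>
     (\<forall>k<degree P. \<forall>l<degree P. k \<noteq> l \<longrightarrow>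
        (\<nexists>x. poly ((pderiv ^^ k) P) x = 0 \<and> poly ((pderiv ^^ l) P) x = 0))"

text \<open>
  A sequence of compatible pairs \<open>((p\<^sub>d, n\<^sub>d), \<dots>, (p\<^sub>1, n\<^sub>1))\<close> is a list of length \<open>d\<close>.
  Its entry at position \<open>k = d - j\<close> is the pair \<open>(p\<^sub>j, n\<^sub>j)\<close>, which belongs
  to the \<open>k\<close>-th derivative.
\<close>

type_synonym scp = "(nat \<times> nat) list"

definition realizes :: "real poly \<Rightarrow> scp \<Rightarrow> bool" where
  "realizes P S \<longleftrightarrow>
     lead_coeff P = 1 \<and> degree P = length S \<and>
     (\<forall>j<degree P. coeff P j \<noteq> 0) \<and>
     all_real_roots_distinct P \<and>
     (\<forall>k<degree P. S ! k = (num_pos_roots ((pderiv ^^ k) P), num_neg_roots ((pderiv ^^ k) P)))"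

definition realizable :: "scp \<Rightarrow> bool" where
  "realizable S \<longleftrightarrow> (\<exists>P. realizes P S)"

text \<open>
  Sign patterns are lists over \<open>1\<close> and \<open>-1\<close>, leading coefficient first. Since the sign of
  \<open>b\<^sub>j\<close> is \<open>(-1) ^ p\<^bsub>d - j\<^esub>\<close>, the signs of \<open>b\<^bsub>d - 1\<^esub>, \<dots>, b\<^sub>0\<close> are determined
  by \<open>p\<^sub>1, \<dots>, p\<^sub>d\<close>, which is the reverse of the order in which the pairs are listed.
\<close>

definition scp_sign_pattern :: "scp \<Rightarrow> int list" where
  "scp_sign_pattern S = 1 # map (\<lambda>(p, n). (-1) ^ p) (rev S)"

definition Sigma_pattern :: "nat list \<Rightarrow> int list" where
  "Sigma_pattern ms = concat (map (\<lambda>i. replicate (ms ! i) ((-1) ^ i)) [0..<length ms])"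

definition S_diamond :: scp where
  "S_diamond = [(0, 2), (2, 3), (1, 3), (1, 2), (1, 1), (1, 0)]"

end

theory Submission
  imports Defs
begin

text \<open>
  Suppose that \<open>P\<close> realizes the sequence. Its derivative has five simple real roots
  \<open>-c\<^sub>1, -c\<^sub>2, -c\<^sub>3 < 0 < a\<^sub>1 < a\<^sub>2\<close>, where \<open>c\<^sub>1\<close> is the largest of the \<open>c\<^sub>i\<close>, and \<open>P\<close>, which has
  no positive root, is positive on the positive half-line. The idea is to reflect at the local
  maximum \<open>a\<^sub>1\<close>: it turns out that \<open>P(a\<^sub>1 - s) \<ge> P(a\<^sub>1 + s) > 0\<close> for
  \<open>0 \<le> s \<le> a\<^sub>1 + c\<^sub>1\<close>. Thus \<open>P\<close> is positive on \<open>[-c\<^sub>1, a\<^sub>1]\<close>. As it decreases up to \<open>-c\<^sub>1\<close>, it is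
  positive further to the left as well, and it has no negative root, although two are prescribed.

  The comparison follows from \<open>P'(a\<^sub>1 - s) + P'(a\<^sub>1 + s) \<le> 0\<close>, which is an inequality between
  the products of the differences of \<open>a\<^sub>1 - s\<close> and of \<open>a\<^sub>1 + s\<close> from the other four roots
  (\<open>reflected_quartic_le\<close>). It holds as soon as \<open>a\<^sub>2\<close> is at least as far from \<open>a\<^sub>1\<close> as \<open>-c\<^sub>1\<close> is.

  This separation of \<open>a\<^sub>2\<close> (\<open>root_separation\<close>) comes from the signs of only two
  coefficients of \<open>P\<close>, those of \<open>x\<^sup>5\<close> and \<open>x\<^sup>2\<close>. Both are negative, because the fifth and the
  second derivative each have exactly one positive root. For the roots of \<open>P'\<close> this says
  \<open>c\<^sub>1 + c\<^sub>2 + c\<^sub>3 < a\<^sub>1 + a\<^sub>2\<close> and \<open>1/c\<^sub>1 + 1/c\<^sub>2 + 1/c\<^sub>3 < 1/a\<^sub>1 + 1/a\<^sub>2\<close>.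
\<close>

section \<open>Real polynomials with simple nonzero real roots\<close>

lemma finite_signed_roots:
  fixes p :: "real poly"
  assumes "p \<noteq> 0"
  shows "finite {x. x > 0 \<and> poly p x = 0}" "finite {x. x < 0 \<and> poly p x = 0}"
  using poly_roots_finite[OF assms] by (auto intro: finite_subset[rotated])

lemma num_roots_eq_card:
  assumes "\<And>x. poly p x = 0 \<Longrightarrow> order x p = 1"
  shows "num_pos_roots p = card {x. x > 0 \<and> poly p x = 0}"
    and "num_neg_roots p = card {x. x < 0 \<and> poly p x = 0}"
  using assms by (simp_all add: num_pos_roots_def num_neg_roots_def)

lemma split_of_card_roots:
  fixes p :: "real poly"
  assumes "\<And>x. x \<in> A \<Longrightarrow> poly p x = 0" and "finite A" and "card A = degree p"
  shows "p = smult (lead_coeff p) (\<Prod>x\<in>A. [:- x, 1:])"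
proof (rule poly_eqI_degree_lead_coeff[where n = "degree p" and A = A])
  have deg: "degree (\<Prod>x\<in>A. [:- x, 1:]) = degree p"
    using assms(3) by (simp add: degree_prod_sum_eq)
  have "lead_coeff (\<Prod>x\<in>A. [:- x, 1:]) = 1"
    by (simp add: lead_coeff_prod)
  then show "coeff p (degree p) = coeff (smult (lead_coeff p) (\<Prod>x\<in>A. [:- x, 1:])) (degree p)"
    by (simp add: deg)
  show "degree (smult (lead_coeff p) (\<Prod>x\<in>A. [:- x, 1:])) \<le> degree p"
    by (simp add: deg)
qed (use assms in \<open>auto simp: poly_prod\<close>)

lemma split_of_num_roots:
  fixes p :: "real poly"
  assumes "p \<noteq> 0" and "\<And>x. poly p x = 0 \<Longrightarrow> order x p = 1"
    and "num_pos_roots p + num_neg_roots p = degree p"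
  shows "p = smult (lead_coeff p)
           ((\<Prod>x | x > 0 \<and> poly p x = 0. [:- x, 1:]) * (\<Prod>x | x < 0 \<and> poly p x = 0. [:- x, 1:]))"
proof -
  let ?A = "{x. x > 0 \<and> poly p x = 0}" and ?B = "{x. x < 0 \<and> poly p x = 0}"
  have fin: "finite ?A" "finite ?B" and disj: "?A \<inter> ?B = {}"
    using finite_signed_roots[OF assms(1)] by auto
  have "card (?A \<union> ?B) = degree p"
    using assms(3) num_roots_eq_card[OF assms(2)] by (simp add: card_Un_disjoint[OF fin disj])
  then have "p = smult (lead_coeff p) (\<Prod>x\<in>?A \<union> ?B. [:- x, 1:])"
    using fin by (intro split_of_card_roots) auto
  then show ?thesis
    by (simp only: prod.union_disjoint[OF fin disj])
qed

text \<open>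
  In the factorization, each positive root contributes one negative factor to the value at zero.
\<close>

lemma value_at_0_sign:
  fixes p :: "real poly"
  assumes "lead_coeff p > 0" and "\<And>x. poly p x = 0 \<Longrightarrow> order x p = 1"
    and "num_pos_roots p + num_neg_roots p = degree p"
  shows "poly p 0 * (- 1) ^ num_pos_roots p > 0"
proof -
  let ?A = "{x. x > 0 \<and> poly p x = 0}" and ?B = "{x. x < 0 \<and> poly p x = 0}"
  have "p \<noteq> 0" using assms(1) by auto
  have "poly p 0 = lead_coeff p * ((\<Prod>x\<in>?A. - x) * (\<Prod>x\<in>?B. - x))"
    by (subst split_of_num_roots[OF \<open>p \<noteq> 0\<close> assms(2,3)]) (simp_all add: poly_prod)
  also have "(\<Prod>x\<in>?A. - x) = (- 1) ^ num_pos_roots p * \<Prod>?A"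
    using num_roots_eq_card[OF assms(2)] by (simp add: prod_uminus)
  finally have "poly p 0 * (- 1) ^ num_pos_roots p =
      lead_coeff p * \<Prod>?A * (\<Prod>x\<in>?B. - x) * ((- 1) ^ num_pos_roots p)\<^sup>2"
    by (simp add: power2_eq_square mult_ac)
  moreover have "\<Prod>?A > 0" "(\<Prod>x\<in>?B. - x) > 0"
    by (auto intro: prod_pos)
  ultimately show ?thesis
    using assms(1) by (simp flip: power_mult add: mult.commute)
qed

lemma poly_pos_of_no_pos_roots:
  fixes p :: "real poly"
  assumes "lead_coeff p > 0" and "\<And>x. x > 0 \<Longrightarrow> poly p x \<noteq> 0" and "y > 0"
  shows "poly p y > 0"
proof (rule ccontr)
  assume "\<not> poly p y > 0"
  then have "poly p y < 0" using assms(2,3) by (simp add: order_less_le)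
  obtain n where n: "\<And>x. x \<ge> n \<Longrightarrow> poly p x \<ge> lead_coeff p"
    using poly_pinfty_gt_lc[OF assms(1)] by blast
  have "poly p (max n (y + 1)) > 0"
    using n[of "max n (y + 1)"] assms(1) by simp
  then show False
    using poly_IVT_pos[of y "max n (y + 1)" p] \<open>poly p y < 0\<close> assms(2,3) by force
qed

section \<open>The position of the critical points\<close>

text \<open>
  If \<open>c\<^sub>2 + c\<^sub>3 < 3 a\<^sub>1\<close>, then already \<open>1/c\<^sub>2 + 1/c\<^sub>3 > 1/a\<^sub>1\<close>, by the inequality between the
  arithmetic and the harmonic mean. The bound on the reciprocals then gives \<open>a\<^sub>2 < c\<^sub>1\<close>, and the
  bound on the sums gives \<open>c\<^sub>2 + c\<^sub>3 < a\<^sub>1\<close>. Now \<open>1/c\<^sub>2 + 1/c\<^sub>3\<close> even exceeds \<open>4/a\<^sub>1\<close>,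
  more than the bound on the reciprocals allows. So \<open>c\<^sub>2 + c\<^sub>3 \<ge> 3 a\<^sub>1\<close>, which turns the bound on
  the sums into the claim.
\<close>

lemma root_separation:
  fixes a1 a2 c1 c2 c3 :: real
  assumes "0 < a1" "a1 < a2" "0 < c1" "0 < c2" "0 < c3"
    and sums: "c1 + c2 + c3 < a1 + a2"
    and recips: "1 / c1 + 1 / c2 + 1 / c3 < 1 / a1 + 1 / a2"
  shows "c1 + a1 \<le> a2 - a1"
proof -
  have am_hm: "4 / (c2 + c3) \<le> 1 / c2 + 1 / c3"
  proof -
    have "4 * (c2 * c3) \<le> (c2 + c3) * (c2 + c3)"
      using zero_le_square[of "c2 - c3"] by (simp add: algebra_simps)
    then have "4 / (c2 + c3) \<le> (c2 + c3) / (c2 * c3)"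
      using assms by (simp add: divide_simps)
    also have "\<dots> = 1 / c2 + 1 / c3"
      using assms by (simp add: field_simps)
    finally show ?thesis .
  qed
  have "3 * a1 \<le> c2 + c3"
  proof (rule ccontr)
    assume "\<not> 3 * a1 \<le> c2 + c3"
    then have "1 / a1 < 4 / (c2 + c3)"
      using assms by (simp add: divide_simps)
    then have "1 / c1 < 1 / a2"
      using recips am_hm by linarith
    then have "a2 < c1"
      using assms by (simp add: divide_simps)
    then have "4 / a1 < 4 / (c2 + c3)"
      using assms by (simp add: divide_simps)
    moreover have "1 / a2 < 1 / a1" "1 / c1 > 0" "4 / a1 = 4 * (1 / a1)" "1 / a1 > 0"
      using assms by (simp_all add: divide_simps)
    ultimately show False
      using recips am_hm by linarith
  qed
  then show ?thesis
    using sums by linarith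
qed

text \<open>
  Put the origin at \<open>a\<^sub>1\<close>. The other roots of \<open>P'\<close> are \<open>D = a\<^sub>2 - a\<^sub>1\<close> and \<open>-d\<^sub>i = -(c\<^sub>i + a\<^sub>1)\<close>.
  The larger \<open>d\<close> is, the closer to 1 the ratio \<open>(d - s) / (d + s)\<close> is; so the factors belonging to
  \<open>D\<close> and \<open>d\<^sub>1\<close> are compared with each other, while for the remaining two it is enough that
  \<open>\<bar>d\<^sub>i - s\<bar> \<le> d\<^sub>i + s\<close>.
\<close>

lemma reflected_quartic_le:
  fixes D d1 d2 d3 s :: real
  assumes "d1 \<le> D" "0 \<le> s" "s \<le> d1" "0 < d2" "0 < d3"
  shows "(D + s) * (d1 - s) * ((d2 - s) * (d3 - s)) \<le> (D - s) * (d1 + s) * ((d2 + s) * (d3 + s))"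
proof -
  have outer: "(D + s) * (d1 - s) \<le> (D - s) * (d1 + s)"
    using mult_left_mono[OF assms(1,2)] by (simp add: algebra_simps)
  have outer_nonneg: "(D + s) * (d1 - s) \<ge> 0"
    using assms by simp
  have inner: "\<bar>(d2 - s) * (d3 - s)\<bar> \<le> (d2 + s) * (d3 + s)"
    unfolding abs_mult using assms by (intro mult_mono) auto
  have "(D + s) * (d1 - s) * ((d2 - s) * (d3 - s)) \<le> (D + s) * (d1 - s) * \<bar>(d2 - s) * (d3 - s)\<bar>"
    using outer_nonneg by (rule mult_left_mono[OF abs_ge_self])
  also have "\<dots> \<le> (D - s) * (d1 + s) * ((d2 + s) * (d3 + s))"
    by (rule mult_mono[OF outer inner order_trans[OF outer_nonneg outer] abs_ge_zero])
  finally show ?thesis .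
qed

section \<open>Positivity to the left\<close>

text \<open>
  The derivative of \<open>s \<mapsto> P(a\<^sub>1 - s) - P(a\<^sub>1 + s)\<close> is \<open>- P'(a\<^sub>1 - s) - P'(a\<^sub>1 + s)\<close>, so this
  difference, which starts at zero, does not decrease for \<open>0 \<le> s \<le> a\<^sub>1 + c\<^sub>1\<close>.
\<close>

lemma positive_by_reflection:
  fixes P :: "real poly" and a1 a2 c1 c2 c3 K :: real
  assumes P': "\<And>x. poly (pderiv P) x = K * ((x - a1) * (x - a2) * (x + c1) * (x + c2) * (x + c3))"
    and "K > 0" "0 < a1" "0 < c2" "c2 \<le> c1" "0 < c3" "c3 \<le> c1"
    and sep: "c1 + a1 \<le> a2 - a1"
    and pos: "\<And>x. x > 0 \<Longrightarrow> poly P x > 0"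
  shows "poly P x > 0"
proof -
  have near: "poly P x > 0" if "- c1 \<le> x" "x \<le> a1" for x
  proof -
    let ?f = "\<lambda>s. poly P (a1 - s) - poly P (a1 + s)"
    have "?f 0 \<le> ?f (a1 - x)"
    proof (rule DERIV_nonneg_imp_nondecreasing[where f = ?f])
      fix s assume s: "0 \<le> s" "s \<le> a1 - x"
      have "(?f has_real_derivative - poly (pderiv P) (a1 - s) - poly (pderiv P) (a1 + s)) (at s)"
        by (auto intro!: derivative_eq_intros)
      moreover have "- poly (pderiv P) (a1 - s) - poly (pderiv P) (a1 + s) \<ge> 0"
      proof -
        let ?L = "(a2 - a1 + s) * (c1 + a1 - s) * ((c2 + a1 - s) * (c3 + a1 - s))"
        let ?R = "(a2 - a1 - s) * (c1 + a1 + s) * ((c2 + a1 + s) * (c3 + a1 + s))"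
        have "?L \<le> ?R"
          using assms s that by (intro reflected_quartic_le) auto
        then have "0 \<le> K * s * (?R - ?L)"
          using s(1) \<open>K > 0\<close> by simp
        also have "\<dots> = - poly (pderiv P) (a1 - s) - poly (pderiv P) (a1 + s)"
          unfolding P' by algebra
        finally show ?thesis .
      qed
      ultimately show "\<exists>y. (?f has_real_derivative y) (at s) \<and> y \<ge> 0"
        by blast
    qed (use that in simp)
    then have "poly P (a1 + (a1 - x)) \<le> poly P x"
      by simp
    moreover have "poly P (a1 + (a1 - x)) > 0"
      using that assms by (intro pos) simp
    ultimately show ?thesis by linarith
  qed
  consider "x > 0" | "- c1 \<le> x" "x \<le> a1" | "x < - c1"
    using \<open>0 < a1\<close> by linarith
  then show ?thesis
  proof cases
    case 3
    have "poly P x \<ge> poly P (- c1)"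
    proof (rule DERIV_nonpos_imp_nonincreasing[where f = "poly P"])
      fix y assume "x \<le> y" "y \<le> - c1"
      then have y: "y \<le> a1" "y \<le> a2" "y \<le> - c1" "y \<le> - c2" "y \<le> - c3"
        using assms by auto
      have "poly (pderiv P) y = - (K * ((a1 - y) * (a2 - y) * (- c1 - y) * (- c2 - y) * (- c3 - y)))"
        unfolding P' by algebra
      also have "\<dots> \<le> 0"
        using y \<open>K > 0\<close> by simp
      finally show "\<exists>z. (poly P has_real_derivative z) (at y) \<and> z \<le> 0"
        using poly_DERIV by blast
    qed (use 3 in simp)
    then show ?thesis
      using near[of "- c1"] assms by simp
  qed (use pos near in auto)
qed

section \<open>The sequence is not realizable\<close>

lemma card_2_ordered:
  fixes A :: "real set"
  assumes "card A = 2"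
  obtains a b where "A = {a, b}" "a < b"
proof -
  obtain a b where "A = {a, b}" "a \<noteq> b"
    using assms by (auto simp: card_2_iff)
  then show ?thesis
    using that[of a b] that[of b a] by (cases a b rule: linorder_cases) auto
qed

lemma card_3_ordered:
  fixes A :: "real set"
  assumes "card A = 3"
  obtains u v w where "A = {u, v, w}" "u < v" "v < w"
proof -
  have fin: "finite A" and ne: "A \<noteq> {}"
    using assms by (auto intro: card_ge_0_finite)
  have "card (A - {Min A}) = 2"
    using assms fin ne by (simp add: card_Diff_singleton)
  then obtain v w where vw: "A - {Min A} = {v, w}" "v < w"
    by (rule card_2_ordered)
  then have "A = {Min A, v, w}"
    using Min_in[OF fin ne] by blast
  moreover have "Min A < v"
    using vw Min_le[OF fin, of v] by (metis Diff_iff insertI1 order_less_le)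
  ultimately show ?thesis
    using vw(2) by (rule that)
qed

lemma S_diamond_not_realizable: "\<not> realizable S_diamond"
proof
  assume "realizable S_diamond"
  then obtain P where P: "realizes P S_diamond"
    unfolding realizable_def by blast
  let ?D = "\<lambda>k. (pderiv ^^ k) P"
  have lead: "lead_coeff P = 1" and "degree P = length S_diamond"
    using P unfolding realizes_def by blast+
  then have deg: "degree P = 6"
    by (simp add: S_diamond_def)
  have simple: "order x (?D k) = 1" if "k < 6" "poly (?D k) x = 0" for k x
    using P that deg unfolding realizes_def all_real_roots_distinct_def by metis
  have counts: "(num_pos_roots (?D k), num_neg_roots (?D k)) = S_diamond ! k" if "k < 6" for k
    using P that deg unfolding realizes_def by metis
  have lead_D: "lead_coeff (?D k) > 0" if "k < 6" for k
    using that lead deg by (simp add: degree_higher_pderiv coeff_higher_pderiv pochhammer_pos)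
  \<comment> \<open>The second and the fifth derivative have only real roots, exactly one of them positive, so
    they are negative at zero, where they are positive multiples of the coefficients.\<close>
  have coeff_neg: "coeff P k < 0" if "k = 2 \<or> k = 5" for k
  proof -
    have one: "num_pos_roots (?D k) = 1" "num_pos_roots (?D k) + num_neg_roots (?D k) = degree (?D k)"
      using that counts[of k] by (auto simp: S_diamond_def degree_higher_pderiv deg)
    have "k < 6" using that by auto
    then have "poly (?D k) 0 < 0"
      using value_at_0_sign[OF lead_D simple one(2)] one(1) by simp
    then have "pochhammer 1 k * coeff P k < 0"
      by (simp add: poly_0_coeff_0 coeff_higher_pderiv)
    then show ?thesis
      using pochhammer_pos[of "1 :: real" k] by (simp add: mult_less_0_iff)
  qed

  let ?Q = "pderiv P"
  have Q_simple: "order x ?Q = 1" if "poly ?Q x = 0" for x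
    using simple[of 1 x] that by simp
  have Q_counts: "num_pos_roots ?Q = 2" "num_neg_roots ?Q = 3"
    using counts[of 1] by (simp_all add: S_diamond_def)
  have Q_deg: "degree ?Q = 5" and Q_lead: "lead_coeff ?Q = 6"
    using deg lead by (simp_all add: degree_pderiv coeff_pderiv)
  have "?Q \<noteq> 0" using Q_deg by auto
  obtain a1 a2 where a: "{x. x > 0 \<and> poly ?Q x = 0} = {a1, a2}" "a1 < a2"
    using Q_counts(1) num_roots_eq_card(1)[OF Q_simple] by (auto elim: card_2_ordered)
  obtain r1 r2 r3 where r: "{x. x < 0 \<and> poly ?Q x = 0} = {r1, r2, r3}" "r1 < r2" "r2 < r3"
    using Q_counts(2) num_roots_eq_card(2)[OF Q_simple] by (auto elim: card_3_ordered)
  have "a1 > 0" "r1 < 0" "r2 < 0" "r3 < 0"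
    using a(1) r(1) by blast+
  define c1 c2 c3 where c: "c1 = - r1" "c2 = - r2" "c3 = - r3"
  have c_pos: "0 < c1" "0 < c2" "0 < c3" and c_le: "c2 \<le> c1" "c3 \<le> c1"
    using \<open>r1 < 0\<close> \<open>r2 < 0\<close> \<open>r3 < 0\<close> r(2,3) by (simp_all add: c)
  have "a2 > 0" using \<open>a1 > 0\<close> a(2) by simp
  have "num_pos_roots ?Q + num_neg_roots ?Q = degree ?Q"
    using Q_counts Q_deg by simp
  from split_of_num_roots[OF \<open>?Q \<noteq> 0\<close> Q_simple this]
  have "?Q = smult 6 ((\<Prod>x\<in>{a1, a2}. [:- x, 1:]) * (\<Prod>x\<in>{r1, r2, r3}. [:- x, 1:]))"
    unfolding a(1) r(1) Q_lead .
  then have Q: "?Q = smult 6 ([:- a1, 1:] * [:- a2, 1:] * [:c1, 1:] * [:c2, 1:] * [:c3, 1:])"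
    using a(2) r(2,3) by (simp add: c mult.assoc del: mult_pCons_left mult_pCons_right)

  have Q_eval: "poly ?Q x = 6 * ((x - a1) * (x - a2) * (x + c1) * (x + c2) * (x + c3))" for x
    unfolding Q poly_smult poly_mult by (simp add: mult.assoc add.commute)
  have sep: "c1 + a1 \<le> a2 - a1"
  proof (rule root_separation)
    \<comment> \<open>Up to positive factors, the coefficient of \<open>x\<^sup>5\<close> in \<open>P\<close> is the negated sum of the roots of \<open>P'\<close>.\<close>
    have "coeff ?Q 4 = 6 * (c1 + c2 + c3 - a1 - a2)"
      unfolding Q by (simp add: eval_nat_numeral)
    moreover have "coeff ?Q 4 < 0"
      using coeff_neg[of 5] by (simp add: coeff_pderiv)
    ultimately show "c1 + c2 + c3 < a1 + a2"
      by simp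
    \<comment> \<open>The coefficient of \<open>x\<^sup>2\<close> in \<open>P\<close> is \<open>P''(0) / 2\<close>, and \<open>P''(0)\<close> is \<open>P'(0) > 0\<close> times the negated
      sum of the reciprocals of the roots of \<open>P'\<close>.\<close>
    have "coeff ?Q 1 = 6 * ((c1 * c2 + c1 * c3 + c2 * c3) * (a1 * a2) - (a1 + a2) * (c1 * c2 * c3))"
      unfolding Q by (simp add: algebra_simps)
    moreover have "coeff ?Q 1 < 0"
      using coeff_neg[of 2] by (simp add: coeff_pderiv numeral_2_eq_2)
    ultimately have "(c1 * c2 + c1 * c3 + c2 * c3) * (a1 * a2) < (a1 + a2) * (c1 * c2 * c3)"
      by simp
    moreover have "c1 * c2 * c3 > 0" "a1 * a2 > 0"
      using \<open>a1 > 0\<close> \<open>a2 > 0\<close> c_pos by simp_all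
    ultimately have "(c1 * c2 + c1 * c3 + c2 * c3) / (c1 * c2 * c3) < (a1 + a2) / (a1 * a2)"
      by (simp only: pos_divide_less_eq pos_less_divide_eq times_divide_eq_left)
    moreover have "(c1 * c2 + c1 * c3 + c2 * c3) / (c1 * c2 * c3) = 1 / c1 + 1 / c2 + 1 / c3"
      using c_pos by (simp add: field_simps)
    moreover have "(a1 + a2) / (a1 * a2) = 1 / a1 + 1 / a2"
      using \<open>a1 > 0\<close> \<open>a2 > 0\<close> by (simp add: field_simps)
    ultimately show "1 / c1 + 1 / c2 + 1 / c3 < 1 / a1 + 1 / a2"
      by linarith
  qed (use \<open>a1 > 0\<close> a(2) c_pos in auto)
  have pos: "poly P x > 0" if "x > 0" for x
  proof (rule poly_pos_of_no_pos_roots[OF _ _ that])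
    have "P \<noteq> 0" using deg by auto
    have "card {x. x > 0 \<and> poly P x = 0} = 0"
      using counts[of 0] num_roots_eq_card(1)[of P] simple[of 0] by (simp add: S_diamond_def)
    then show "poly P y \<noteq> 0" if "y > 0" for y
      using that finite_signed_roots(1)[OF \<open>P \<noteq> 0\<close>] by auto
  qed (use lead in simp)
  have "poly P x > 0" for x
    by (rule positive_by_reflection[OF Q_eval _ \<open>a1 > 0\<close> c_pos(2) c_le(1) c_pos(3) c_le(2) sep pos]) simp
  then have "num_neg_roots P = 0"
    by (simp add: num_neg_roots_def order_less_imp_not_eq2)
  then show False
    using counts[of 0] by (simp add: S_diamond_def)
qed

theorem theorem1:
  "scp_sign_pattern S_diamond = Sigma_pattern [1, 4, 2] \<and> \<not> realizable S_diamond"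
proof
  show "scp_sign_pattern S_diamond = Sigma_pattern [1, 4, 2]"
    by (simp add: scp_sign_pattern_def S_diamond_def Sigma_pattern_def numeral_eq_Suc)
qed (rule S_diamond_not_realizable)

end
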